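(* Let $G$ be a group and $\mathbb{K}$ a field. Let $D$, $D'$ be $G$-graded division algebras over $\mathbb{K}$, let $V$, $V'$ be finite-dimensional $G$-graded right modules over $D$ and $D'$ respectively, and let $\mathscr{F}: 0=V_0\subset V_1\subset\cdots\subset V_r=V$ and $\mathscr{F}': 0=V_0'\subset V_1'\subset\cdots\subset V'_{r'}=V'$ be graded flags on $V$ and $V'$ respectively. Put $R=\mathrm{End}_D\,\mathscr{F}$ and $R'=\mathrm{End}_{D'}\,\mathscr{F}'$. If $\psi:R\rightarrow R'$ is an isomorphism of $G$-graded algebras, then $r=r'$ and there exist $g\in G$ and an isomorphism $(\psi_0,\psi_1)$ from the pair $({}^{[g^{-1}]}D^{[g]},\mathscr{F}^{[g]})$ to the pair $(D',\mathscr{F}')$ such that $\psi_1(rv)=\psi(r)\psi_1(v)$ for every $r\in R$ and every $v\in V$.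
   Context: Algebras are associative and unital. A $G$-grading on a vector space $V$ is a decomposition $V=\bigoplus_{g\in G}V_g$; a subspace $W$ is homogeneous if $W=\bigoplus_g (W\cap V_g)$. An isomorphism of $G$-graded vector spaces (algebras) is a linear (algebra) isomorphism $f$ with $f(V_g)=W_g$ for all $g$. A $G$-graded algebra satisfies $A_gA_h\subseteq A_{gh}$, and a $G$-graded right $A$-module satisfies $V_hA_g\subseteq V_{hg}$. A graded division algebra is a (nonzero) $G$-graded algebra in which every nonzero homogeneous element is invertible. Graded right modules over a graded division algebra are free and are called (graded) vector spaces over it; dimension means rank. A graded flag on $V$ of length $r\ge 1$ is a chain $0=V_0\subset V_1\subset\cdots\subset V_r=V$ of homogeneous $D$-subspaces with strict inclusions. $\mathrm{End}_D\,\mathscr{F}$ is the algebra of all $\varphi\in\mathrm{End}_D V$ (acting on the left) with $\varphi(V_i)\subseteq V_i$ for all $i$. An endomorphism $\varphi$ is homogeneous of degree $\tau$ if $\varphi(V_g)\subseteq V_{\tau g}$ for all $g$; for $V$ finite-dimensional this makes $\mathrm{End}_D V$ a $G$-graded algebra and $\mathrm{End}_D\,\mathscr{F}$ a homogeneous subalgebra, which is given the induced grading. Isomorphism of pairs: for graded flags $\mathscr{F}$ and $\mathscr{F}'$ of the same length $r$, an isomorphism $(D,\mathscr{F})\to(D',\mathscr{F}')$ is a pair $(\psi_0,\psi_1)$ with $\psi_0:D\to D'$ an isomorphism of graded algebras and $\psi_1:V\to V'$ an isomorphism of graded vector spaces such that $\psi_1(V_i)=V_i'$ for $i=0,\dots,r$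 and $\psi_1(vd)=\psi_1(v)\psi_0(d)$ for all $v\in V$, $d\in D$. Shifts: $V^{[g]}$ is $V$ with the grading $(V^{[g]})_{hg}:=V_h$; ${}^{[g]}V$ is $V$ with the grading $({}^{[g]}V)_{gh}:=V_h$. Thus ${}^{[g^{-1}]}D^{[g]}$ is the algebra $D$ in which $D_h$ is given degree $g^{-1}hg$; it is a graded division algebra, $V^{[g]}$ is a graded right module over it, and $\mathscr{F}^{[g]}$ denotes the flag $V_0^{[g]}\subset V_1^{[g]}\subset\cdots\subset V_r^{[g]}$. *)

theory Defs
  imports Complex_Main
begin

text \<open>
  The field of scalars, the graded division algebras and the modules over them are types; the
  scalar multiplications, the right actions and the gradings are parameters. The grading group is
  a type of class \<open>group_add\<close>: this class does not assume commutativity, so it covers all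
  groups, but the group is written additively (\<open>g + h\<close> for the product \<open>gh\<close>,
  \<open>- g\<close> for the inverse).
\<close>

definition (in module) internal_direct_sum :: "'b set \<Rightarrow> ('g \<Rightarrow> 'b set) \<Rightarrow> bool"
  where "internal_direct_sum W U \<longleftrightarrow>
    (\<forall>g. subspace (U g) \<and> U g \<subseteq> W) \<and>
    (\<forall>w\<in>W. \<exists>!f. (\<forall>g. f g \<in> U g) \<and> finite {g. f g \<noteq> 0} \<and> w = (\<Sum>g | f g \<noteq> 0. f g))"

locale graded_space = vector_space scale
  for scale :: "'k::field \<Rightarrow> 'v::ab_group_add \<Rightarrow> 'v" +
  fixes gr :: "'g::group_add \<Rightarrow> 'v set"
  assumes grading: "internal_direct_sum UNIV gr"
begin

definition homogeneous :: "'v set \<Rightarrow> bool"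
  where "homogeneous W \<longleftrightarrow> subspace W \<and> internal_direct_sum W (\<lambda>g. W \<inter> gr g)"

end

locale graded_algebra = graded_space scale gr
  for scale :: "'k::field \<Rightarrow> 'd::ring_1 \<Rightarrow> 'd" and gr :: "'g::group_add \<Rightarrow> 'd set" +
  assumes scale_mult_left: "scale a x * y = scale a (x * y)"
    and scale_mult_right: "x * scale a y = scale a (x * y)"
    and mult_degree: "x \<in> gr g \<Longrightarrow> y \<in> gr h \<Longrightarrow> x * y \<in> gr (g + h)"

text \<open>Nonzeroness of the algebra is part of the class \<open>ring_1\<close>.\<close>

locale graded_division_algebra = graded_algebra scale gr
  for scale :: "'k::field \<Rightarrow> 'd::ring_1 \<Rightarrow> 'd" and gr :: "'g::group_add \<Rightarrow> 'd set" +
  assumes homogeneous_invertible: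
    "x \<in> gr g \<Longrightarrow> x \<noteq> 0 \<Longrightarrow> \<exists>y. x * y = 1 \<and> y * x = 1"

locale graded_right_module =
  D: graded_algebra scaleD grD + V: graded_space scaleV grV
  for scaleD :: "'k::field \<Rightarrow> 'd::ring_1 \<Rightarrow> 'd" and grD :: "'g::group_add \<Rightarrow> 'd set"
    and scaleV :: "'k \<Rightarrow> 'v::ab_group_add \<Rightarrow> 'v" and grV :: "'g \<Rightarrow> 'v set" +
  fixes act :: "'v \<Rightarrow> 'd \<Rightarrow> 'v"  (infixl "\<cdot>" 70)
  assumes act_add_left: "(v + w) \<cdot> x = v \<cdot> x + w \<cdot> x"
    and act_add_right: "v \<cdot> (x + y) = v \<cdot> x + v \<cdot> y"
    and act_scale_left: "scaleV a v \<cdot> x = scaleV a (v \<cdot> x)"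
    and act_scale_right: "v \<cdot> scaleD a x = scaleV a (v \<cdot> x)"
    and act_mult: "v \<cdot> (x * y) = v \<cdot> x \<cdot> y"
    and act_one: "v \<cdot> 1 = v"
    and act_degree: "v \<in> grV h \<Longrightarrow> x \<in> grD g \<Longrightarrow> v \<cdot> x \<in> grV (h + g)"
begin

text \<open>Finite rank: there is a finite basis of homogeneous elements.\<close>

definition finite_rank :: bool
  where "finite_rank \<longleftrightarrow>
    (\<exists>B. finite B \<and> B \<subseteq> (\<Union>g. grV g) \<and>
      (\<forall>v. \<exists>!c. (\<forall>b. b \<notin> B \<longrightarrow> c b = 0) \<and> v = (\<Sum>b\<in>B. b \<cdot> c b)))"

text \<open>A flag of length \<open>r\<close> is a sequence of which only the members \<open>0, \<dots>, r\<close> matter.\<close>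

definition graded_flag :: "nat \<Rightarrow> (nat \<Rightarrow> 'v set) \<Rightarrow> bool"
  where "graded_flag r F \<longleftrightarrow>
    1 \<le> r \<and> F 0 = {0} \<and> F r = UNIV \<and> (\<forall>i<r. F i \<subset> F (Suc i)) \<and>
    (\<forall>i\<le>r. V.homogeneous (F i) \<and> (\<forall>v\<in>F i. \<forall>x. v \<cdot> x \<in> F i))"

end

definition End_flag ::
  "('k::field \<Rightarrow> 'v::ab_group_add \<Rightarrow> 'v) \<Rightarrow> ('v \<Rightarrow> 'd \<Rightarrow> 'v) \<Rightarrow> nat \<Rightarrow> (nat \<Rightarrow> 'v set) \<Rightarrow> ('v \<Rightarrow> 'v) set"
  where "End_flag scaleV act r F =
    {\<phi>. Vector_Spaces.linear scaleV scaleV \<phi> \<and> (\<forall>v x. \<phi> (act v x) = act (\<phi> v) x) \<and>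
        (\<forall>i\<le>r. \<phi> ` F i \<subseteq> F i)}"

definition End_flag_degree ::
  "('k::field \<Rightarrow> 'v::ab_group_add \<Rightarrow> 'v) \<Rightarrow> ('g::group_add \<Rightarrow> 'v set) \<Rightarrow> ('v \<Rightarrow> 'd \<Rightarrow> 'v) \<Rightarrow>
    nat \<Rightarrow> (nat \<Rightarrow> 'v set) \<Rightarrow> 'g \<Rightarrow> ('v \<Rightarrow> 'v) set"
  where "End_flag_degree scaleV grV act r F t =
    {\<phi> \<in> End_flag scaleV act r F. \<forall>g. \<phi> ` grV g \<subseteq> grV (t + g)}"

text \<open>
  Isomorphisms of graded algebras between two algebras of endomorphisms, whose operations are the
  pointwise addition and scalar multiplication, and composition. The algebras are given by
  their carriers \<open>R\<close>, \<open>R'\<close> and families of components \<open>grR\<close>, \<open>grR'\<close>.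
\<close>

definition graded_endo_algebra_iso ::
  "('k::field \<Rightarrow> 'v::ab_group_add \<Rightarrow> 'v) \<Rightarrow> ('v \<Rightarrow> 'v) set \<Rightarrow> ('g \<Rightarrow> ('v \<Rightarrow> 'v) set) \<Rightarrow>
   ('k \<Rightarrow> 'w::ab_group_add \<Rightarrow> 'w) \<Rightarrow> ('w \<Rightarrow> 'w) set \<Rightarrow> ('g \<Rightarrow> ('w \<Rightarrow> 'w) set) \<Rightarrow>
   (('v \<Rightarrow> 'v) \<Rightarrow> 'w \<Rightarrow> 'w) \<Rightarrow> bool"
  where "graded_endo_algebra_iso scaleV R grR scaleV' R' grR' \<psi> \<longleftrightarrow>
    bij_betw \<psi> R R' \<and>
    (\<forall>\<phi>\<in>R. \<forall>\<chi>\<in>R. \<psi> (\<lambda>v. \<phi> v + \<chi> v) = (\<lambda>w. \<psi> \<phi> w + \<psi> \<chi> w)) \<and>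
    (\<forall>a. \<forall>\<phi>\<in>R. \<psi> (\<lambda>v. scaleV a (\<phi> v)) = (\<lambda>w. scaleV' a (\<psi> \<phi> w))) \<and>
    (\<forall>\<phi>\<in>R. \<forall>\<chi>\<in>R. \<psi> (\<phi> \<circ> \<chi>) = \<psi> \<phi> \<circ> \<psi> \<chi>) \<and>
    \<psi> id = id \<and>
    (\<forall>t. \<psi> ` grR t = grR' t)"

definition graded_space_iso ::
  "('k::field \<Rightarrow> 'v::ab_group_add \<Rightarrow> 'v) \<Rightarrow> ('g \<Rightarrow> 'v set) \<Rightarrow>
   ('k \<Rightarrow> 'w::ab_group_add \<Rightarrow> 'w) \<Rightarrow> ('g \<Rightarrow> 'w set) \<Rightarrow> ('v \<Rightarrow> 'w) \<Rightarrow> bool"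
  where "graded_space_iso scaleV grV scaleW grW f \<longleftrightarrow>
    Vector_Spaces.linear scaleV scaleW f \<and> bij f \<and> (\<forall>g. f ` grV g = grW g)"

definition graded_algebra_iso ::
  "('k::field \<Rightarrow> 'd::ring_1 \<Rightarrow> 'd) \<Rightarrow> ('g \<Rightarrow> 'd set) \<Rightarrow>
   ('k \<Rightarrow> 'e::ring_1 \<Rightarrow> 'e) \<Rightarrow> ('g \<Rightarrow> 'e set) \<Rightarrow> ('d \<Rightarrow> 'e) \<Rightarrow> bool"
  where "graded_algebra_iso scaleD grD scaleE grE f \<longleftrightarrow>
    graded_space_iso scaleD grD scaleE grE f \<and> (\<forall>x y. f (x * y) = f x * f y) \<and> f 1 = 1"

text \<open>
  The defining equations of the shifts are \<open>rshift g U (h + g) = U h\<close> and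
  \<open>lshift g U (g + h) = U h\<close>; they change only the grading, not the underlying space.
\<close>

definition rshift :: "'g::group_add \<Rightarrow> ('g \<Rightarrow> 'v set) \<Rightarrow> 'g \<Rightarrow> 'v set"
  where "rshift g U = (\<lambda>h. U (h + - g))"

definition lshift :: "'g::group_add \<Rightarrow> ('g \<Rightarrow> 'v set) \<Rightarrow> 'g \<Rightarrow> 'v set"
  where "lshift g U = (\<lambda>h. U (- g + h))"

lemma rshift_add: "rshift g U (h + g) = U h"
  by (simp add: rshift_def)

lemma lshift_add: "lshift g U (g + h) = U h"
  by (simp add: lshift_def)

text \<open>Isomorphisms of pairs (graded division algebra, graded flag of length \<open>r\<close>).\<close>

definition pair_iso ::
  "nat \<Rightarrow>
   ('k::field \<Rightarrow> 'd::ring_1 \<Rightarrow> 'd) \<Rightarrow> ('g \<Rightarrow> 'd set) \<Rightarrow>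
   ('k \<Rightarrow> 'v::ab_group_add \<Rightarrow> 'v) \<Rightarrow> ('g \<Rightarrow> 'v set) \<Rightarrow> ('v \<Rightarrow> 'd \<Rightarrow> 'v) \<Rightarrow> (nat \<Rightarrow> 'v set) \<Rightarrow>
   ('k \<Rightarrow> 'e::ring_1 \<Rightarrow> 'e) \<Rightarrow> ('g \<Rightarrow> 'e set) \<Rightarrow>
   ('k \<Rightarrow> 'w::ab_group_add \<Rightarrow> 'w) \<Rightarrow> ('g \<Rightarrow> 'w set) \<Rightarrow> ('w \<Rightarrow> 'e \<Rightarrow> 'w) \<Rightarrow> (nat \<Rightarrow> 'w set) \<Rightarrow>
   ('d \<Rightarrow> 'e) \<Rightarrow> ('v \<Rightarrow> 'w) \<Rightarrow> bool"
  where "pair_iso r scaleD grD scaleV grV act F scaleD' grD' scaleV' grV' act' F' \<psi>0 \<psi>1 \<longleftrightarrow>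
    graded_algebra_iso scaleD grD scaleD' grD' \<psi>0 \<and>
    graded_space_iso scaleV grV scaleV' grV' \<psi>1 \<and>
    (\<forall>i\<le>r. \<psi>1 ` F i = F' i) \<and>
    (\<forall>v d. \<psi>1 (act v d) = act' (\<psi>1 v) (\<psi>0 d))"

end

theory Submission
  imports Defs
begin

text \<open>
  Pick a homogeneous \<open>v\<close> outside \<open>V\<^bsub>r-1\<^esub>\<close> and a graded functional \<open>f\<close> with \<open>f v = 1\<close> that
  vanishes on \<open>V\<^bsub>r-1\<^esub>\<close>. The rank-one maps \<open>u f\<close> with \<open>u \<in> V\<close> all preserve the flag, so with the
  idempotent \<open>e = v f\<close> of degree \<open>0\<close> the left ideal \<open>R e\<close> is a copy of the module \<open>V\<close> and \<open>e R e\<close>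
  is a copy of \<open>D\<close>. Faithfulness of \<open>R e\<close> and invertibility of the nonzero elements of degree
  \<open>0\<close> of \<open>e R e\<close> force \<open>\<psi> e\<close> to have the same shape \<open>w f'\<close> with \<open>w\<close> homogeneous outside
  \<open>V'\<^bsub>r'-1\<^esub>\<close>. Then \<open>\<psi>\<^sub>1 u = \<psi> (u f) w\<close> and \<open>\<psi>\<^sub>1 (v d) = w \<psi>\<^sub>0 d\<close>, and \<open>g\<close> is the quotient of the
  degrees of \<open>v\<close> and \<open>w\<close>. The flag is recovered from \<open>R\<close>: its members are exactly the homogeneous
  \<open>R\<close>-submodules of \<open>V\<close>.
\<close>

section \<open>Homogeneous components\<close>

context graded_space
begin

definition component :: "'g \<Rightarrow> 'v \<Rightarrow> 'v"
  where "component g v =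
    (THE f. (\<forall>g. f g \<in> gr g) \<and> finite {g. f g \<noteq> 0} \<and> v = (\<Sum>g | f g \<noteq> 0. f g)) g"

text \<open>Any finite set outside which \<open>f\<close> vanishes may replace the exact support,
  because the extra terms are zero; uniqueness in the direct sum does the rest.\<close>

lemma component_unique:
  assumes f: "\<And>g. f g \<in> gr g" and S: "finite S" "\<And>g. g \<notin> S \<Longrightarrow> f g = 0" and v: "v = sum f S"
  shows "component g v = f g"
proof -
  let ?P = "\<lambda>f. (\<forall>g. f g \<in> gr g) \<and> finite {g. f g \<noteq> 0} \<and> v = (\<Sum>g | f g \<noteq> 0. f g)"
  have sub: "{g. f g \<noteq> 0} \<subseteq> S" using S by auto
  then have "v = (\<Sum>g | f g \<noteq> 0. f g)"
    unfolding v by (intro sum.mono_neutral_right) (use S in auto)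
  then have P: "?P f" using f sub S(1) finite_subset by blast
  have ex1: "\<exists>!f. ?P f" using grading unfolding internal_direct_sum_def by blast
  have "(THE f. ?P f) = f" by (rule the1_equality[where P = ?P, OF ex1 P])
  then show ?thesis by (simp add: component_def)
qed

lemma
  shows component_in: "component g v \<in> gr g"
    and finite_components: "finite {g. component g v \<noteq> 0}"
    and sum_components: "(\<Sum>g | component g v \<noteq> 0. component g v) = v"
proof -
  let ?P = "\<lambda>f. (\<forall>g. f g \<in> gr g) \<and> finite {g. f g \<noteq> 0} \<and> v = (\<Sum>g | f g \<noteq> 0. f g)"
  have ex1: "\<exists>!f. ?P f" using grading unfolding internal_direct_sum_def by blast
  then have "?P (THE f. ?P f)" by (rule theI')
  moreover have "(THE f. ?P f) = (\<lambda>g. component g v)" by (simp add: component_def)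
  ultimately have "?P (\<lambda>g. component g v)" by simp
  then show "component g v \<in> gr g" "finite {g. component g v \<noteq> 0}"
    "(\<Sum>g | component g v \<noteq> 0. component g v) = v" by simp_all
qed

lemma subspace_gr: "subspace (gr g)"
  using grading unfolding internal_direct_sum_def by blast

lemma component_homogeneous:
  assumes "v \<in> gr h"
  shows "component g v = (if g = h then v else 0)"
  by (rule component_unique[where S = "{h}"])
    (use assms subspace_gr subspace_0 in auto)

lemma component_zero [simp]: "component g 0 = 0"
  by (rule component_unique[where S = "{}"]) (use subspace_gr subspace_0 in auto)

lemma component_add: "component g (v + w) = component g v + component g w"
proof (rule component_unique[where S = "{g. component g v \<noteq> 0} \<union> {g. component g w \<noteq> 0}"])
  let ?S = "{g. component g v \<noteq> 0} \<union> {g. component g w \<noteq> 0}"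
  have fin: "finite ?S" using finite_components by simp
  have "sum (\<lambda>g. component g v) ?S = v" "sum (\<lambda>g. component g w) ?S = w"
    by (subst sum_components[symmetric], rule sum.mono_neutral_right; use fin in auto)+
  then show "v + w = (\<Sum>g\<in>?S. component g v + component g w)" by (simp add: sum.distrib)
  show "finite ?S" by (fact fin)
qed (use component_in subspace_gr subspace_add in auto)

text \<open>A vector is a finite sum of its components. Only closure under addition is asked of
  \<open>S\<close>, so the rule also proves additive identities by checking them on homogeneous
  vectors.\<close>

lemma mem_if_components:
  assumes "0 \<in> S" and "\<And>v w. v \<in> S \<Longrightarrow> w \<in> S \<Longrightarrow> v + w \<in> S" and "\<And>g. component g v \<in> S"
  shows "v \<in> S"
proof -
  have "sum (\<lambda>g. component g v) A \<in> S" if "finite A" for A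
    using that by induction (use assms in auto)
  then show ?thesis using sum_components finite_components by metis
qed

lemma exists_homogeneous_not_in:
  assumes "0 \<in> S" and "\<And>v w. v \<in> S \<Longrightarrow> w \<in> S \<Longrightarrow> v + w \<in> S" and "v \<notin> S"
  obtains g where "component g v \<notin> S"
  using mem_if_components assms by blast

lemma homogeneous_component:
  assumes "homogeneous W" and "w \<in> W"
  shows "component g w \<in> W"
proof -
  obtain f where f: "\<forall>g. f g \<in> W \<inter> gr g" "finite {g. f g \<noteq> 0}" "w = (\<Sum>g | f g \<noteq> 0. f g)"
    using assms unfolding homogeneous_def internal_direct_sum_def by blast
  then have "component g w = f g" by (intro component_unique[where S = "{g. f g \<noteq> 0}"]) auto
  then show ?thesis using f by simp
qed

end

text \<open>Both sides are additive in \<open>v\<close>, so homogeneous \<open>v\<close> suffice;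
  injectivity of \<open>\<sigma>\<close> keeps distinct degrees apart. In the applications
  \<open>\<sigma>\<close> is a left or right translation of the group.\<close>

lemma component_additive_map:
  assumes "graded_space s gr" and "graded_space s' gr'"
    and add: "\<And>v w. f (v + w) = f v + f w"
    and deg: "\<And>h v. v \<in> gr h \<Longrightarrow> f v \<in> gr' (\<sigma> h)" and "inj \<sigma>"
  shows "graded_space.component gr' (\<sigma> h) (f v) = f (graded_space.component gr h v)"
proof -
  interpret A: graded_space s gr by fact
  interpret B: graded_space s' gr' by fact
  have zero: "f 0 = 0" using add[of 0 0] by simp
  let ?S = "{v. B.component (\<sigma> h) (f v) = f (A.component h v)}"
  have "v \<in> ?S"
  proof (rule A.mem_if_components)
    show "0 \<in> ?S" using zero by simp
    show "v + w \<in> ?S" if "v \<in> ?S" "w \<in> ?S" for v w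
      using that by (simp add: add A.component_add B.component_add)
    show "A.component g v \<in> ?S" for g
      using B.component_homogeneous[OF deg[OF A.component_in]]
        A.component_homogeneous[OF A.component_in] \<open>inj \<sigma>\<close> zero
      by (auto simp: inj_eq)
  qed
  then show ?thesis by simp
qed

section \<open>Graded functionals\<close>

locale graded_vector_space =
  graded_right_module scaleD grD scaleV grV act + D: graded_division_algebra scaleD grD
  for scaleD :: "'k::field \<Rightarrow> 'd::ring_1 \<Rightarrow> 'd" and grD :: "'g::group_add \<Rightarrow> 'd set"
    and scaleV :: "'k \<Rightarrow> 'v::ab_group_add \<Rightarrow> 'v" and grV :: "'g \<Rightarrow> 'v set"
    and act :: "'v \<Rightarrow> 'd \<Rightarrow> 'v"  (infixl "\<cdot>" 70)
begin

lemma act_zero_left [simp]: "0 \<cdot> x = 0"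
  using act_add_left[of 0 0 x] by simp

lemma act_zero_right [simp]: "v \<cdot> 0 = 0"
  using act_add_right[of v 0 0] by simp

lemma act_minus_left: "(- v) \<cdot> x = - (v \<cdot> x)"
  using act_add_left[of v "- v" x] by (simp add: minus_unique)

lemma act_minus_right: "v \<cdot> (- x) = - (v \<cdot> x)"
  using act_add_right[of v x "- x"] by (simp add: minus_unique)

lemma act_diff_right: "v \<cdot> (x - y) = v \<cdot> x - v \<cdot> y"
  using act_add_right[of v x "- y"] by (simp add: act_minus_right)

lemma component_act:
  assumes "x \<in> grV a"
  shows "V.component (a + h) (x \<cdot> d) = x \<cdot> D.component h d"
  by (rule component_additive_map[where \<sigma> = "\<lambda>h. a + h"])
    (unfold_locales, auto simp: act_add_right act_degree assms inj_def)

text \<open>Homogeneity is phrased as closure under components. Closure under negatives and scalars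
  comes from acting by scalar multiples of \<open>1\<close>.\<close>

definition graded_subspace :: "'v set \<Rightarrow> bool"
  where "graded_subspace M \<longleftrightarrow> 0 \<in> M \<and> (\<forall>v\<in>M. \<forall>w\<in>M. v + w \<in> M) \<and>
    (\<forall>v\<in>M. \<forall>x. v \<cdot> x \<in> M) \<and> (\<forall>v\<in>M. \<forall>g. V.component g v \<in> M)"

lemma graded_subspaceD:
  assumes "graded_subspace M"
  shows "0 \<in> M" "v \<in> M \<Longrightarrow> w \<in> M \<Longrightarrow> v + w \<in> M" "v \<in> M \<Longrightarrow> v \<cdot> x \<in> M"
    "v \<in> M \<Longrightarrow> V.component g v \<in> M" "v \<in> M \<Longrightarrow> - v \<in> M" "v \<in> M \<Longrightarrow> w \<in> M \<Longrightarrow> v - w \<in> M"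
proof -
  show neg: "- v \<in> M" if "v \<in> M" for v
    using assms that act_minus_right[of v 1] act_one[of v] unfolding graded_subspace_def by metis
  show "v \<in> M \<Longrightarrow> w \<in> M \<Longrightarrow> v - w \<in> M"
    using assms neg[of w] unfolding graded_subspace_def by (metis diff_conv_add_uminus)
qed (use assms in \<open>auto simp: graded_subspace_def\<close>)

lemma graded_subspace_zero: "graded_subspace {0}"
  by (simp add: graded_subspace_def)

lemma subset_add_span: "M \<subseteq> {m + x \<cdot> d | m d. m \<in> M}"
proof
  fix m assume "m \<in> M"
  then have "m + x \<cdot> 0 \<in> {m + x \<cdot> d | m d. m \<in> M}" by blast
  then show "m \<in> {m + x \<cdot> d | m d. m \<in> M}" by simp
qed

text \<open>Homogeneity is the point: the degree \<open>g\<close> component of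
  \<open>x \<cdot> d\<close> is \<open>x\<close> acted on by the component of \<open>d\<close> in
  degree \<open>- b + g\<close>.\<close>

lemma graded_subspace_add_span:
  assumes M: "graded_subspace M" and x: "x \<in> grV b"
  shows "graded_subspace {m + x \<cdot> d | m d. m \<in> M}" (is "graded_subspace ?N")
  unfolding graded_subspace_def
proof (intro conjI ballI allI)
  show "0 \<in> ?N" using graded_subspaceD(1)[OF M] subset_add_span by blast
  fix v assume "v \<in> ?N"
  then obtain m d where v: "v = m + x \<cdot> d" "m \<in> M" by blast
  show "v + w \<in> ?N" if "w \<in> ?N" for w
  proof -
    obtain m' d' where w: "w = m' + x \<cdot> d'" "m' \<in> M" using \<open>w \<in> ?N\<close> by blast
    have "v + w = (m + m') + x \<cdot> (d + d')" by (simp add: v w act_add_right)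
    then show ?thesis using v w graded_subspaceD(2)[OF M] by blast
  qed
  show "v \<cdot> y \<in> ?N" for y
  proof -
    have "v \<cdot> y = m \<cdot> y + x \<cdot> (d * y)" by (simp add: v act_add_left act_mult)
    then show ?thesis using v graded_subspaceD(3)[OF M] by blast
  qed
  show "V.component g v \<in> ?N" for g
  proof -
    have "V.component g v = V.component g m + x \<cdot> D.component (- b + g) d"
      using component_act[OF x, of "- b + g" d] by (simp add: v V.component_add add.assoc[symmetric])
    then show ?thesis using v graded_subspaceD(4)[OF M] by blast
  qed
qed

text \<open>A nonzero \<open>d\<close> would have an invertible homogeneous component. Being
  homogeneous, \<open>M\<close> would contain \<open>u\<close> times this component, hence
  \<open>u\<close> itself.\<close>

lemma act_in_graded_subspace:
  assumes M: "graded_subspace M" and u: "u \<in> grV a" "u \<notin> M" and "u \<cdot> d \<in> M"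
  shows "d = 0"
proof (rule ccontr)
  assume "d \<noteq> 0"
  then obtain h where h: "D.component h d \<noteq> 0"
    using D.exists_homogeneous_not_in[of "{0}" d] by auto
  then obtain y where "D.component h d * y = 1"
    using D.homogeneous_invertible[OF D.component_in] by blast
  then have "u = u \<cdot> D.component h d \<cdot> y" by (simp add: act_mult[symmetric] act_one)
  moreover have "u \<cdot> D.component h d \<in> M"
    using graded_subspaceD(4)[OF M \<open>u \<cdot> d \<in> M\<close>] component_act[OF u(1)] by metis
  ultimately show False using graded_subspaceD(3)[OF M] u(2) by metis
qed

lemma act_cancel:
  assumes "u \<in> grV a" "u \<noteq> 0" "u \<cdot> d = u \<cdot> d'"
  shows "d = d'"
  using act_in_graded_subspace[OF graded_subspace_zero, of u a "d - d'"] assms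
  by (simp add: act_diff_right)

text \<open>A right \<open>D\<close>-linear map from \<open>V\<close> to \<open>D\<close> of degree
  \<open>- a\<close>; the sign is chosen so that a vector of degree \<open>a\<close> can be sent to
  \<open>1\<close>.\<close>

definition graded_functional :: "'g \<Rightarrow> ('v \<Rightarrow> 'd) \<Rightarrow> bool"
  where "graded_functional a f \<longleftrightarrow> (\<forall>v w. f (v + w) = f v + f w) \<and>
    (\<forall>v x. f (v \<cdot> x) = f v * x) \<and> (\<forall>h. \<forall>v\<in>grV h. f v \<in> grD (- a + h))"

text \<open>The kernel of the functional is a graded subspace maximal among those that contain \<open>W\<close>
  but not \<open>u\<close>.\<close>

lemma exists_graded_functional:
  assumes W: "graded_subspace W" and u: "u \<in> grV a" "u \<notin> W"
  obtains f where "graded_functional a f" "f u = 1" "\<And>w. w \<in> W \<Longrightarrow> f w = 0"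
proof -
  let ?A = "{M. graded_subspace M \<and> W \<subseteq> M \<and> u \<notin> M}"
  have "\<exists>M\<in>?A. \<forall>X\<in>?A. M \<subseteq> X \<longrightarrow> X = M"
  proof (rule subset_Zorn_nonempty)
    show "?A \<noteq> {}" using W u by blast
    fix C assume C: "C \<noteq> {}" "subset.chain ?A C"
    then have sub: "\<And>M. M \<in> C \<Longrightarrow> graded_subspace M \<and> W \<subseteq> M \<and> u \<notin> M"
      unfolding subset.chain_def by blast
    have "v + w \<in> \<Union>C" if vw: "v \<in> \<Union>C" "w \<in> \<Union>C" for v w
    proof -
      obtain X Y where XY: "v \<in> X" "X \<in> C" "w \<in> Y" "Y \<in> C" using vw by blast
      then have "X \<subseteq> Y \<or> Y \<subseteq> X" using C(2) unfolding subset.chain_def by blast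
      then have "\<exists>Z\<in>C. v \<in> Z \<and> w \<in> Z" using XY by blast
      then show ?thesis using sub graded_subspaceD(2) by blast
    qed
    then have "graded_subspace (\<Union>C)"
      unfolding graded_subspace_def
    proof (intro conjI ballI allI)
      show "0 \<in> \<Union>C" using C(1) sub graded_subspaceD(1) by blast
      show "v \<cdot> x \<in> \<Union>C" "V.component g v \<in> \<Union>C" if "v \<in> \<Union>C" for v x g
        using that sub graded_subspaceD(3,4) by (meson UnionE UnionI)+
    qed
    then show "\<Union>C \<in> ?A" using C(1) sub by blast
  qed
  then obtain M where "M \<in> ?A" and M_max: "\<forall>X\<in>?A. M \<subseteq> X \<longrightarrow> X = M" by (elim bexE)
  then have M: "graded_subspace M" and WM: "W \<subseteq> M" and uM: "u \<notin> M" by simp_all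
  have max: "X = M" if "graded_subspace X" "M \<subseteq> X" "u \<notin> X" for X
    using M_max that WM by simp
  let ?T = "{m + u \<cdot> d | m d. m \<in> M}"
  have T: "graded_subspace ?T" by (rule graded_subspace_add_span[OF M u(1)])
  have MT: "M \<subseteq> ?T" by (rule subset_add_span)
  \<comment> \<open>If \<open>x\<close> is not in \<open>M\<close>, maximality puts \<open>u\<close>
    into \<open>M + x D\<close>. Taking components in degree \<open>a\<close> makes the coefficient
    of \<open>x\<close> homogeneous; it is nonzero because \<open>u\<close> is not in
    \<open>M\<close>, so the equation can be solved for \<open>x\<close>.\<close>
  have hom: "x \<in> ?T" if x: "x \<in> grV b" for x b
  proof (cases "x \<in> M")
    case False
    let ?N = "{m + x \<cdot> d | m d. m \<in> M}"
    have "0 + x \<cdot> 1 \<in> ?N" using graded_subspaceD(1)[OF M] by blast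
    then have "?N \<noteq> M" using False by (metis act_one add_0)
    moreover have "M \<subseteq> ?N" by (rule subset_add_span)
    ultimately have "u \<in> ?N" using max[OF graded_subspace_add_span[OF M x]] by blast
    then obtain m d where md: "u = m + x \<cdot> d" "m \<in> M" by blast
    let ?c = "D.component (- b + a) d"
    have "u = V.component a u" using V.component_homogeneous[OF u(1)] by simp
    also have "\<dots> = V.component a m + x \<cdot> ?c"
      using component_act[OF x, of "- b + a" d]
      by (simp add: md(1) V.component_add add.assoc[symmetric])
    finally have uc: "u = V.component a m + x \<cdot> ?c" .
    have mM: "V.component a m \<in> M" using graded_subspaceD(4)[OF M md(2)] .
    have "?c \<noteq> 0" using uc mM uM by (metis act_zero_right add_0_right)
    then obtain y where "?c * y = 1" using D.homogeneous_invertible[OF D.component_in] by blast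
    then have "x = x \<cdot> ?c \<cdot> y" by (simp add: act_mult[symmetric] act_one)
    also have "x \<cdot> ?c = u - V.component a m" using uc by (simp add: algebra_simps)
    also have "(u - V.component a m) \<cdot> y = - (V.component a m \<cdot> y) + u \<cdot> y"
      using act_add_left[of u "- V.component a m" y] by (simp add: act_minus_left)
    finally have "x = - (V.component a m \<cdot> y) + u \<cdot> y" .
    then show ?thesis using graded_subspaceD(3,5)[OF M] mM by blast
  qed (use MT in blast)
  have "v \<in> ?T" for v
    by (rule V.mem_if_components) (use hom V.component_in graded_subspaceD[OF T] in blast)+
  moreover have "\<exists>d. v - u \<cdot> d \<in> M" if v: "v \<in> ?T" for v
  proof -
    obtain m d where "v = m + u \<cdot> d" "m \<in> M" using v by blast
    then show ?thesis by (intro exI[of _ d]) simp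
  qed
  ultimately have "\<forall>v. \<exists>d. v - u \<cdot> d \<in> M" by blast
  then obtain f where f: "\<And>v. v - u \<cdot> f v \<in> M" by metis
  \<comment> \<open>The coefficient of \<open>u\<close> modulo \<open>M\<close> is unique, so each
    property of \<open>f\<close> reduces to a membership in \<open>M\<close>.\<close>
  have f_eq: "f v = d" if "v - u \<cdot> d \<in> M" for v d
  proof -
    have "u \<cdot> (f v - d) = (v - u \<cdot> d) - (v - u \<cdot> f v)" by (simp add: act_diff_right)
    then have "u \<cdot> (f v - d) \<in> M" using graded_subspaceD(6)[OF M that f] by metis
    then show ?thesis using act_in_graded_subspace[OF M u(1) uM] by fastforce
  qed
  have "f (v + w) = f v + f w" for v w
  proof (rule f_eq)
    have "v + w - u \<cdot> (f v + f w) = (v - u \<cdot> f v) + (w - u \<cdot> f w)"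
      by (simp add: act_add_right)
    then show "v + w - u \<cdot> (f v + f w) \<in> M" using graded_subspaceD(2)[OF M f f] by metis
  qed
  moreover have "f (v \<cdot> x) = f v * x" for v x
  proof (rule f_eq)
    have "v \<cdot> x - u \<cdot> (f v * x) = (v - u \<cdot> f v) \<cdot> x"
      using act_add_left[of v "- (u \<cdot> f v)" x] by (simp add: act_minus_left act_mult)
    then show "v \<cdot> x - u \<cdot> (f v * x) \<in> M" using graded_subspaceD(3)[OF M f] by metis
  qed
  moreover have "f v \<in> grD (- a + h)" if v: "v \<in> grV h" for v h
  proof -
    \<comment> \<open>Because \<open>M\<close> is homogeneous, the degree \<open>h\<close> component
      of \<open>v - u \<cdot> f v\<close> is in \<open>M\<close>; it shows that the homogeneous
      element \<open>?d\<close> is already a valid coefficient.\<close>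
    let ?d = "D.component (- a + h) (f v)"
    have "V.component h v = V.component h (v - u \<cdot> f v) + V.component h (u \<cdot> f v)"
      by (simp add: V.component_add[symmetric])
    moreover have "V.component h (u \<cdot> f v) = u \<cdot> ?d"
      using component_act[OF u(1), of "- a + h" "f v"] by (simp add: add.assoc[symmetric])
    moreover have "V.component h v = v" using V.component_homogeneous[OF v] by simp
    ultimately have "v - u \<cdot> ?d = V.component h (v - u \<cdot> f v)" by (simp add: algebra_simps)
    then have "f v = ?d" using f_eq[of v ?d] graded_subspaceD(4)[OF M f[of v]] by metis
    then show ?thesis using D.component_in by metis
  qed
  ultimately have "graded_functional a f" by (simp add: graded_functional_def)
  moreover have "f u = 1" using f_eq[of u 1] graded_subspaceD(1)[OF M] by (simp add: act_one)
  moreover have "f w = 0" if "w \<in> W" for w using f_eq[of w 0] WM that by auto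
  ultimately show thesis by (rule that)
qed

end

section \<open>Endomorphisms of graded flags\<close>

locale flagged_vector_space =
  graded_vector_space scaleD grD scaleV grV act
  for scaleD :: "'k::field \<Rightarrow> 'd::ring_1 \<Rightarrow> 'd" and grD :: "'g::group_add \<Rightarrow> 'd set"
    and scaleV :: "'k \<Rightarrow> 'v::ab_group_add \<Rightarrow> 'v" and grV :: "'g \<Rightarrow> 'v set"
    and act :: "'v \<Rightarrow> 'd \<Rightarrow> 'v"  (infixl "\<cdot>" 70) +
  fixes r :: nat and F :: "nat \<Rightarrow> 'v set"
  assumes flag: "graded_flag r F"
begin

abbreviation R :: "('v \<Rightarrow> 'v) set"
  where "R \<equiv> End_flag scaleV act r F"

abbreviation R_degree :: "'g \<Rightarrow> ('v \<Rightarrow> 'v) set"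
  where "R_degree \<equiv> End_flag_degree scaleV grV act r F"

lemma r_pos: "1 \<le> r" and F_0: "F 0 = {0}" and F_r: "F r = UNIV"
  and F_strict: "i < r \<Longrightarrow> F i \<subset> F (Suc i)"
  using flag unfolding graded_flag_def by auto

lemma F_mono:
  assumes "i \<le> j" "j \<le> r"
  shows "F i \<subseteq> F j"
  using assms by (induction rule: dec_induct) (use F_strict in \<open>auto dest: Suc_le_lessD\<close>)

lemma F_less:
  assumes "i < j" "j \<le> r"
  shows "F i \<subset> F j"
  using F_mono[of "Suc i" j] F_strict[of i] assms by auto

lemma graded_subspace_F:
  assumes "i \<le> r"
  shows "graded_subspace (F i)"
proof -
  have hom: "V.homogeneous (F i)" and act: "\<And>v x. v \<in> F i \<Longrightarrow> v \<cdot> x \<in> F i"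
    using flag assms unfolding graded_flag_def by auto
  have "V.subspace (F i)" using hom unfolding V.homogeneous_def by blast
  then show ?thesis
    unfolding graded_subspace_def
    using act V.homogeneous_component[OF hom] V.subspace_0 V.subspace_add by blast
qed

lemma R_D:
  assumes "\<phi> \<in> R"
  shows "\<phi> (v + w) = \<phi> v + \<phi> w" "\<phi> (scaleV k v) = scaleV k (\<phi> v)" "\<phi> (v \<cdot> x) = \<phi> v \<cdot> x"
    "i \<le> r \<Longrightarrow> v \<in> F i \<Longrightarrow> \<phi> v \<in> F i" "\<phi> 0 = 0"
proof -
  have lin: "Vector_Spaces.linear scaleV scaleV \<phi>" using assms by (simp add: End_flag_def)
  then interpret L: Vector_Spaces.linear scaleV scaleV \<phi> .
  show "\<phi> (v + w) = \<phi> v + \<phi> w" "\<phi> (scaleV k v) = scaleV k (\<phi> v)" "\<phi> 0 = 0"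
    by (simp_all add: L.add L.scale L.zero)
  show "\<phi> (v \<cdot> x) = \<phi> v \<cdot> x" using assms by (simp add: End_flag_def)
  show "i \<le> r \<Longrightarrow> v \<in> F i \<Longrightarrow> \<phi> v \<in> F i" using assms by (fastforce simp: End_flag_def)
qed

lemma R_I:
  assumes "\<And>v w. \<phi> (v + w) = \<phi> v + \<phi> w" "\<And>k v. \<phi> (scaleV k v) = scaleV k (\<phi> v)"
    "\<And>v x. \<phi> (v \<cdot> x) = \<phi> v \<cdot> x" "\<And>i v. i \<le> r \<Longrightarrow> v \<in> F i \<Longrightarrow> \<phi> v \<in> F i"
  shows "\<phi> \<in> R"
proof -
  have "Vector_Spaces.linear scaleV scaleV \<phi>"
    by unfold_locales (simp_all add: assms V.scale_right_distrib V.scale_left_distrib)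
  then show ?thesis using assms by (auto simp: End_flag_def)
qed

lemma comp_in_R: "\<phi> \<in> R \<Longrightarrow> \<chi> \<in> R \<Longrightarrow> \<phi> \<circ> \<chi> \<in> R"
  by (rule R_I) (simp_all add: R_D)

lemma zero_in_R: "(\<lambda>v. 0) \<in> R"
  by (rule R_I) (use graded_subspaceD(1)[OF graded_subspace_F] in auto)

lemma R_degreeD:
  assumes "\<phi> \<in> R_degree t"
  shows "\<phi> \<in> R" "v \<in> grV h \<Longrightarrow> \<phi> v \<in> grV (t + h)"
  using assms unfolding End_flag_degree_def by auto

lemma comp_in_R_degree:
  assumes "\<phi> \<in> R_degree t" "\<chi> \<in> R_degree s"
  shows "\<phi> \<circ> \<chi> \<in> R_degree (t + s)"
proof -
  have "(\<phi> \<circ> \<chi>) v \<in> grV (t + s + h)" if "v \<in> grV h" for v h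
    using R_degreeD(2)[OF assms(1) R_degreeD(2)[OF assms(2) that]] by (simp add: add.assoc)
  then show ?thesis
    using comp_in_R[OF R_degreeD(1)[OF assms(1)] R_degreeD(1)[OF assms(2)]]
    unfolding End_flag_degree_def by blast
qed

text \<open>Acting by \<open>scaleD k 1\<close> is scaling by \<open>k\<close>, so linearity over
  \<open>D\<close> yields linearity over the field.\<close>

lemma functional_scale:
  assumes "graded_functional a f"
  shows "f (scaleV k v) = scaleD k (f v)"
proof -
  have "f (scaleV k v) = f (v \<cdot> scaleD k 1)" by (simp add: act_scale_right act_one)
  also have "\<dots> = f v * scaleD k 1" using assms by (simp add: graded_functional_def)
  finally show ?thesis by (simp add: D.scale_mult_right)
qed

text \<open>The members of the flag up to \<open>F i\<close> are killed, and all later ones contain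
  \<open>u\<close>.\<close>

lemma rank_one_in_R:
  assumes f: "graded_functional a f" and i: "i < r" and kill: "\<And>v. v \<in> F i \<Longrightarrow> f v = 0"
    and u: "u \<in> F (Suc i)"
  shows "(\<lambda>v. u \<cdot> f v) \<in> R"
proof (rule R_I)
  show "u \<cdot> f (v + w) = u \<cdot> f v + u \<cdot> f w" "u \<cdot> f (v \<cdot> x) = u \<cdot> f v \<cdot> x" for v w x
    using f by (simp_all add: graded_functional_def act_add_right act_mult)
  show "u \<cdot> f (scaleV k v) = scaleV k (u \<cdot> f v)" for k v
    by (simp add: functional_scale[OF f] act_scale_right)
  show "u \<cdot> f v \<in> F j" if "j \<le> r" "v \<in> F j" for j v
  proof (cases "j \<le> i")
    case True
    then have "f v = 0" using kill that F_mono[of j i] i by auto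
    then show ?thesis using graded_subspaceD(1)[OF graded_subspace_F[OF that(1)]] by simp
  next
    case False
    then have "u \<in> F j" using F_mono[of "Suc i" j] that u by auto
    then show ?thesis by (rule graded_subspaceD(3)[OF graded_subspace_F[OF that(1)]])
  qed
qed

lemma rank_one_degree:
  assumes f: "graded_functional a f" and R: "(\<lambda>v. u \<cdot> f v) \<in> R" and u: "u \<in> grV b"
  shows "(\<lambda>v. u \<cdot> f v) \<in> R_degree (b + - a)"
proof -
  have "u \<cdot> f v \<in> grV (b + - a + h)" if "v \<in> grV h" for h v
  proof -
    have "f v \<in> grD (- a + h)" using f that by (simp add: graded_functional_def)
    then show ?thesis using act_degree[OF u] by (metis add.assoc)
  qed
  then show ?thesis using R unfolding End_flag_degree_def by blast
qed

lemma exists_functional_F: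
  assumes "i \<le> r" and "u \<in> grV a" "u \<notin> F i"
  obtains f where "graded_functional a f" "f u = 1" "\<And>w. w \<in> F i \<Longrightarrow> f w = 0"
  using exists_graded_functional[OF graded_subspace_F[OF assms(1)] assms(2,3)] by blast

text \<open>Formulated through \<open>R\<close> and the components alone, so that it can be carried
  along an isomorphism of the endomorphism algebras.\<close>

definition graded_submodule :: "'v set \<Rightarrow> bool"
  where "graded_submodule S \<longleftrightarrow> 0 \<in> S \<and> (\<forall>v\<in>S. \<forall>w\<in>S. v + w \<in> S) \<and>
    (\<forall>\<phi>\<in>R. \<forall>v\<in>S. \<phi> v \<in> S) \<and> (\<forall>v\<in>S. \<forall>g. V.component g v \<in> S)"

lemma graded_submoduleD:
  assumes "graded_submodule S"
  shows "0 \<in> S" "v \<in> S \<Longrightarrow> w \<in> S \<Longrightarrow> v + w \<in> S" "\<phi> \<in> R \<Longrightarrow> v \<in> S \<Longrightarrow> \<phi> v \<in> S"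
    "v \<in> S \<Longrightarrow> V.component g v \<in> S"
  using assms by (simp_all add: graded_submodule_def)

lemma graded_submodule_F: "i \<le> r \<Longrightarrow> graded_submodule (F i)"
  unfolding graded_submodule_def
  using graded_subspaceD(1,2,4)[OF graded_subspace_F] by (simp add: R_D(4))

text \<open>For the least \<open>i\<close> with \<open>S \<subseteq> F i\<close> and
  \<open>i > 0\<close>, some homogeneous \<open>u\<close> in \<open>S\<close> lies outside the
  preceding member. With a functional \<open>f\<close> that kills that member and has
  \<open>f u = 1\<close>, the rank-one maps \<open>x f\<close> with \<open>x\<close> in
  \<open>F i\<close> belong to \<open>R\<close> and send \<open>u\<close> to every such
  \<open>x\<close>.\<close>

lemma graded_submodule_iff: "graded_submodule S \<longleftrightarrow> S \<in> F ` {..r}"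
proof
  assume S: "graded_submodule S"
  define i where "i = (LEAST i. S \<subseteq> F i)"
  have Si: "S \<subseteq> F i" unfolding i_def by (rule LeastI[of "\<lambda>i. S \<subseteq> F i" r]) (simp add: F_r)
  have ir: "i \<le> r" unfolding i_def by (rule Least_le[of "\<lambda>i. S \<subseteq> F i"]) (simp add: F_r)
  have "S = F i"
  proof (cases i)
    case 0
    then show ?thesis using Si S F_0 by (auto simp: graded_submodule_def)
  next
    case (Suc k)
    have "\<not> S \<subseteq> F k" using not_less_Least[of k "\<lambda>i. S \<subseteq> F i"] Suc unfolding i_def by auto
    then obtain s where s: "s \<in> S" "s \<notin> F k" by blast
    have kr: "k \<le> r" "k < r" using Suc ir by auto
    obtain g where g: "V.component g s \<notin> F k"
      using V.exists_homogeneous_not_in[OF graded_subspaceD(1,2)[OF graded_subspace_F[OF kr(1)]] s(2)]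
      by blast
    have uS: "V.component g s \<in> S" using S s by (simp add: graded_submodule_def)
    obtain f where f: "graded_functional g f" "f (V.component g s) = 1" "\<And>w. w \<in> F k \<Longrightarrow> f w = 0"
      using exists_functional_F[OF kr(1) V.component_in g] by blast
    have "x \<in> S" if "x \<in> F i" for x
    proof -
      have "(\<lambda>v. x \<cdot> f v) \<in> R" using rank_one_in_R[OF f(1) kr(2) f(3)] that Suc by simp
      then have "x \<cdot> f (V.component g s) \<in> S" using S uS by (auto simp: graded_submodule_def)
      then show ?thesis by (simp add: f(2) act_one)
    qed
    then show ?thesis using Si by blast
  qed
  then show "S \<in> F ` {..r}" using ir by blast
qed (use graded_submodule_F in auto)

end

text \<open>This recovers the index of a member from the unordered set of all members.\<close>

lemma strict_chain_card_below:
  fixes A :: "nat \<Rightarrow> 'a set"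
  assumes chain: "\<And>i j. i < j \<Longrightarrow> j \<le> n \<Longrightarrow> A i \<subset> A j" and "i \<le> n"
  shows "card {S \<in> A ` {..n}. S \<subset> A i} = i"
proof -
  have inj: "inj_on A {..n}"
    by (rule linorder_inj_onI) (use chain in auto)
  have "j < i" if "j \<le> n" "A j \<subset> A i" for j
    using chain[of i j] that \<open>i \<le> n\<close> by (cases i j rule: linorder_cases) auto
  then have "{S \<in> A ` {..n}. S \<subset> A i} = A ` {..<i}"
    using chain[of _ i] \<open>i \<le> n\<close> by fastforce
  moreover have "inj_on A {..<i}" using inj \<open>i \<le> n\<close> by (auto intro: inj_on_subset)
  ultimately show ?thesis by (simp add: card_image)
qed

text \<open>A common member has equally many members strictly below it in either chain, hence the
  same index in both.\<close>

lemma strict_chains_equal: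
  fixes A B :: "nat \<Rightarrow> 'a set"
  assumes A: "\<And>i j. i < j \<Longrightarrow> j \<le> n \<Longrightarrow> A i \<subset> A j"
    and B: "\<And>i j. i < j \<Longrightarrow> j \<le> m \<Longrightarrow> B i \<subset> B j"
    and eq: "A ` {..n} = B ` {..m}"
  shows "n = m" and "i \<le> n \<Longrightarrow> A i = B i"
proof -
  have *: "A i = B i \<and> i \<le> m" if i: "i \<le> n" for i
  proof -
    obtain k where k: "k \<le> m" "A i = B k" using eq i by blast
    have "i = k"
      using strict_chain_card_below[of n A, OF A i] strict_chain_card_below[of m B, OF B k(1)]
      by (simp add: k(2) eq)
    then show ?thesis using k by simp
  qed
  then show "i \<le> n \<Longrightarrow> A i = B i" by blast
  have "B m \<in> A ` {..n}" by (simp add: eq)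
  then obtain k where k: "k \<le> n" "A k = B m" by auto
  have "B k = B m" "k \<le> m" using *[OF k(1)] k(2) by simp_all
  then have "k = m" using B[of k m] by (auto simp: le_less)
  then show "n = m" using k(1) *[of n] by simp
qed

section \<open>Isomorphisms of endomorphism algebras\<close>

theorem theorem1:
  fixes scaleD :: "'k::field \<Rightarrow> 'd::ring_1 \<Rightarrow> 'd" and grD :: "'g::group_add \<Rightarrow> 'd set"
    and scaleD' :: "'k \<Rightarrow> 'e::ring_1 \<Rightarrow> 'e" and grD' :: "'g \<Rightarrow> 'e set"
    and scaleV :: "'k \<Rightarrow> 'v::ab_group_add \<Rightarrow> 'v" and grV :: "'g \<Rightarrow> 'v set"
    and act :: "'v \<Rightarrow> 'd \<Rightarrow> 'v"
    and scaleV' :: "'k \<Rightarrow> 'w::ab_group_add \<Rightarrow> 'w" and grV' :: "'g \<Rightarrow> 'w set"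
    and act' :: "'w \<Rightarrow> 'e \<Rightarrow> 'w"
    and r r' :: nat and F :: "nat \<Rightarrow> 'v set" and F' :: "nat \<Rightarrow> 'w set"
    and \<psi> :: "('v \<Rightarrow> 'v) \<Rightarrow> 'w \<Rightarrow> 'w"
  assumes "graded_division_algebra scaleD grD"
    and "graded_division_algebra scaleD' grD'"
    and "graded_right_module scaleD grD scaleV grV act"
    and "graded_right_module scaleD' grD' scaleV' grV' act'"
    and "graded_right_module.finite_rank grV act"
    and "graded_right_module.finite_rank grV' act'"
    and "graded_right_module.graded_flag scaleV grV act r F"
    and "graded_right_module.graded_flag scaleV' grV' act' r' F'"
    and "graded_endo_algebra_iso
      scaleV (End_flag scaleV act r F) (End_flag_degree scaleV grV act r F)
      scaleV' (End_flag scaleV' act' r' F') (End_flag_degree scaleV' grV' act' r' F') \<psi>"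
  shows "r = r' \<and>
    (\<exists>g \<psi>0 \<psi>1.
      pair_iso r
        scaleD (lshift (- g) (rshift g grD)) scaleV (rshift g grV) act F
        scaleD' grD' scaleV' grV' act' F' \<psi>0 \<psi>1 \<and>
      (\<forall>\<phi>\<in>End_flag scaleV act r F. \<forall>v. \<psi>1 (\<phi> v) = \<psi> \<phi> (\<psi>1 v)))"
proof -

  \<comment> \<open>The two flags and the properties of \<open>\<psi>\<close>\<close>
  interpret A: flagged_vector_space scaleD grD scaleV grV act r F
    using assms
    by (simp add: flagged_vector_space_def graded_vector_space_def flagged_vector_space_axioms_def)
  interpret B: flagged_vector_space scaleD' grD' scaleV' grV' act' r' F'
    using assms
    by (simp add: flagged_vector_space_def graded_vector_space_def flagged_vector_space_axioms_def)
  have bij: "bij_betw \<psi> A.R B.R"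
    and \<psi>_add: "\<And>\<phi> \<chi>. \<phi> \<in> A.R \<Longrightarrow> \<chi> \<in> A.R \<Longrightarrow> \<psi> (\<lambda>v. \<phi> v + \<chi> v) = (\<lambda>w. \<psi> \<phi> w + \<psi> \<chi> w)"
    and \<psi>_scale: "\<And>k \<phi>. \<phi> \<in> A.R \<Longrightarrow> \<psi> (\<lambda>v. scaleV k (\<phi> v)) = (\<lambda>w. scaleV' k (\<psi> \<phi> w))"
    and \<psi>_comp: "\<And>\<phi> \<chi>. \<phi> \<in> A.R \<Longrightarrow> \<chi> \<in> A.R \<Longrightarrow> \<psi> (\<phi> \<circ> \<chi>) = \<psi> \<phi> \<circ> \<psi> \<chi>"
    and \<psi>_degree: "\<And>t. \<psi> ` A.R_degree t = B.R_degree t"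
    using assms(9) unfolding graded_endo_algebra_iso_def by auto
  have \<psi>_in: "\<psi> \<phi> \<in> B.R" if "\<phi> \<in> A.R" for \<phi>
    using bij that by (auto simp: bij_betw_def)
  have \<psi>_inj: "\<phi> = \<chi>" if "\<psi> \<phi> = \<psi> \<chi>" "\<phi> \<in> A.R" "\<chi> \<in> A.R" for \<phi> \<chi>
    using bij that by (auto simp: bij_betw_def inj_on_def)
  have \<psi>_surj: "\<exists>\<phi>\<in>A.R. \<psi> \<phi> = \<chi>" if "\<chi> \<in> B.R" for \<chi>
    using bij that by (metis bij_betw_def imageE)
  have \<psi>_degree_in: "\<psi> \<phi> \<in> B.R_degree t" if "\<phi> \<in> A.R_degree t" for \<phi> t
    using that \<psi>_degree by (metis imageI)
  have \<psi>_degree_surj: "\<exists>\<phi>\<in>A.R_degree t. \<psi> \<phi> = \<chi>" if "\<chi> \<in> B.R_degree t" for \<chi> t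
    using that \<psi>_degree by (metis imageE)
  have \<psi>_zero: "\<psi> (\<lambda>v. 0) = (\<lambda>w. 0)"
    using \<psi>_scale[OF A.zero_in_R, of 0] by simp

  \<comment> \<open>A homogeneous vector and a dual functional at the top of
    \<open>F\<close>\<close>
  define s where "s = r - 1"
  \<comment> \<open>\<open>F s\<close> is the largest proper member of the flag; it exists because
    \<open>1 \<le> r\<close>.\<close>
  have s: "s < r" "s \<le> r" "Suc s = r" using A.r_pos by (simp_all add: s_def)
  define s' where "s' = r' - 1"
  have s': "s' < r'" "s' \<le> r'" "Suc s' = r'" using B.r_pos by (simp_all add: s'_def)
  note Fs = A.graded_subspaceD[OF A.graded_subspace_F[OF s(2)]]
    and Fs' = B.graded_subspaceD[OF B.graded_subspace_F[OF s'(2)]]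
  obtain v0 where "v0 \<notin> F s" using A.F_strict[OF s(1)] s A.F_r by auto
  then obtain a where "A.V.component a v0 \<notin> F s"
    using A.V.exists_homogeneous_not_in[of "F s" v0] Fs(1,2) by blast
  then obtain v where v: "v \<in> grV a" "v \<notin> F s" using A.V.component_in by blast
  have v0: "v \<noteq> 0" using v(2) Fs(1) by blast
  obtain f where f: "A.graded_functional a f" "f v = 1" "\<And>x. x \<in> F s \<Longrightarrow> f x = 0"
    using A.exists_functional_F[OF s(2) v] by blast
  have f_add: "\<And>x y. f (x + y) = f x + f y" and f_act: "\<And>x d. f (act x d) = f x * d"
    and f_degree: "\<And>h x. x \<in> grV h \<Longrightarrow> f x \<in> grD (- a + h)"
    using f(1) by (simp_all add: A.graded_functional_def)

  \<comment> \<open>The rank-one maps of \<open>R\<close> and the idempotent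
    \<open>p v\<close>\<close>
  define p where "p u = (\<lambda>x. act u (f x))" for u
  have p_in: "p u \<in> A.R" for u
    unfolding p_def using A.rank_one_in_R[OF f(1) s(1) f(3)] s(3) A.F_r by simp
  have p_degree: "p u \<in> A.R_degree (h + - a)" if "u \<in> grV h" for u h
    using A.rank_one_degree[OF f(1) _ that] p_in[of u] unfolding p_def by blast
  have p_v: "p u v = u" for u by (simp add: p_def f(2) A.act_one)
  \<comment> \<open>Together with \<open>p_v\<close> and \<open>p_e\<close> below, this identifies
    \<open>V\<close> with the left ideal generated by \<open>p v\<close>, as modules over
    \<open>R\<close>.\<close>
  have comp_p: "\<phi> \<circ> p u = p (\<phi> u)" if "\<phi> \<in> A.R" for \<phi> u
    using A.R_D(3)[OF that] by (simp add: p_def fun_eq_iff)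
  have p_e: "p u \<circ> p v = p u" for u
    using comp_p[OF p_in] by (simp add: p_v)

  \<comment> \<open>The image \<open>e\<close> of the idempotent\<close>
  define e where "e = \<psi> (p v)"
  have e_in: "e \<in> B.R" unfolding e_def by (rule \<psi>_in[OF p_in])
  have "p v \<in> A.R_degree 0" using p_degree[OF v(1)] by simp
  then have e_degree: "e \<in> B.R_degree 0" unfolding e_def by (rule \<psi>_degree_in)
  have \<psi>_p_e: "\<psi> (p u) (e x) = \<psi> (p u) x" for u x
    using \<psi>_comp[OF p_in p_in, of u v] by (simp add: p_e e_def fun_eq_iff)
  have e_e: "e (e x) = e x" for x
    using \<psi>_p_e[of v] by (simp add: e_def)

  \<comment> \<open>Otherwise \<open>R' e\<close> maps into \<open>F' s'\<close>, so a nonzero map that vanishes there annihilates it,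
    whereas \<open>R\<close> acts faithfully on the corresponding left ideal.\<close>
  have "\<exists>x. e x \<notin> F' s'"
  proof (rule ccontr)
    assume e_Fs': "\<nexists>x. e x \<notin> F' s'"
    obtain z0 where "z0 \<notin> F' s'" using B.F_strict[OF s'(1)] s' B.F_r by auto
    then obtain c where "B.V.component c z0 \<notin> F' s'"
      using B.V.exists_homogeneous_not_in[of "F' s'" z0] Fs'(1,2) by blast
    then obtain z where z: "z \<in> grV' c" "z \<notin> F' s'" using B.V.component_in by blast
    obtain k where k: "B.graded_functional c k" "k z = 1" "\<And>x. x \<in> F' s' \<Longrightarrow> k x = 0"
      using B.exists_functional_F[OF s'(2) z] by blast
    let ?\<chi> = "\<lambda>x. act' z (k x)"
    have "?\<chi> \<in> B.R"
      using B.rank_one_in_R[OF k(1) s'(1) k(3)] s'(3) B.F_r by simp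
    then obtain \<phi> where \<phi>: "\<phi> \<in> A.R" "\<psi> \<phi> = ?\<chi>" using \<psi>_surj by blast
    have "\<phi> u = 0" for u
    proof -
      have "\<psi> (p u) x \<in> F' s'" for x
        using B.R_D(4)[OF \<psi>_in[OF p_in] s'(2), of "e x"] e_Fs' by (simp add: \<psi>_p_e)
      then have "\<psi> (\<phi> \<circ> p u) = \<psi> (\<lambda>v. 0)"
        using \<psi>_comp[OF \<phi>(1) p_in] by (simp add: \<phi>(2) k(3) \<psi>_zero fun_eq_iff)
      then have "\<phi> \<circ> p u = (\<lambda>v. 0)"
        by (rule \<psi>_inj) (use A.comp_in_R[OF \<phi>(1) p_in] A.zero_in_R in auto)
      then have "(\<phi> \<circ> p u) v = 0" by simp
      then show ?thesis by (simp add: p_v)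
    qed
    then have "\<phi> = (\<lambda>v. 0)" by auto
    then have "?\<chi> z = 0" using \<phi>(2) \<psi>_zero by (metis (full_types))
    then show False using z(2) Fs'(1) by (simp add: k(2) B.act_one)
  qed
  then obtain y0 where "e y0 \<notin> F' s'" by blast
  \<comment> \<open>The preimage of \<open>F' s'\<close> under \<open>e\<close> is closed under
    addition, so some component of \<open>y0\<close> lies outside it. Since \<open>e\<close> has
    degree \<open>0\<close>, the vector \<open>w\<close> obtained from it is homogeneous.\<close>
  then obtain b where "e (B.V.component b y0) \<notin> F' s'"
    using B.V.exists_homogeneous_not_in[of "{x. e x \<in> F' s'}" y0] Fs'(1,2) B.R_D(1,5)[OF e_in]
    by auto
  define w where "w = e (B.V.component b y0)"
  have w: "w \<in> grV' b" "w \<notin> F' s'"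
    using B.R_degreeD(2)[OF e_degree B.V.component_in, of b y0] \<open>e (B.V.component b y0) \<notin> F' s'\<close>
    by (simp_all add: w_def)
  have w0: "w \<noteq> 0" using w(2) Fs'(1) by blast
  have e_w: "e w = w" by (simp add: w_def e_e)
  obtain f' where f': "B.graded_functional b f'" "f' w = 1" "\<And>x. x \<in> F' s' \<Longrightarrow> f' x = 0"
    using B.exists_functional_F[OF s'(2) w] by blast
  have f'_add: "\<And>x y. f' (x + y) = f' x + f' y" and f'_act: "\<And>x d. f' (act' x d) = f' x * d"
    and f'_degree: "\<And>h x. x \<in> grV' h \<Longrightarrow> f' x \<in> grD' (- b + h)"
    using f'(1) by (simp_all add: B.graded_functional_def)

  \<comment> \<open>Rank-one maps on \<open>V'\<close> and the shape of \<open>e\<close>\<close>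
  define q where "q u = (\<lambda>x. act' u (f' x)) \<circ> e" for u
  have q0_in: "(\<lambda>x. act' u (f' x)) \<in> B.R" for u
    using B.rank_one_in_R[OF f'(1) s'(1) f'(3)] s'(3) B.F_r by simp
  have q_in: "q u \<in> B.R" for u
    unfolding q_def by (rule B.comp_in_R[OF q0_in e_in])
  have q_degree: "q u \<in> B.R_degree (h + - b)" if "u \<in> grV' h" for u h
    using B.comp_in_R_degree[OF B.rank_one_degree[OF f'(1) q0_in that] e_degree]
    unfolding q_def by simp
  have q_w: "q u w = u" for u by (simp add: q_def e_w f'(2) B.act_one)
  \<comment> \<open>The factor \<open>e\<close> in \<open>q u\<close> gives
    \<open>q u \<circ> e = q u\<close>. Pulled back along \<open>\<psi>\<close>, this reads
    \<open>\<phi> \<circ> p v = \<phi>\<close>, and the left side is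
    \<open>p (\<phi> v)\<close>.\<close>
  have q_preimage: "\<phi> = p (\<phi> v)" if "\<phi> \<in> A.R" "\<psi> \<phi> = q u" for \<phi> u
  proof -
    have "\<psi> (\<phi> \<circ> p v) = \<psi> \<phi>"
      using \<psi>_comp[OF that(1) p_in] by (simp add: that(2) q_def e_def[symmetric] e_e fun_eq_iff)
    then have "\<phi> \<circ> p v = \<phi>"
      by (rule \<psi>_inj) (use A.comp_in_R[OF that(1) p_in] that in auto)
    then show ?thesis using comp_p[OF that(1)] by metis
  qed

  \<comment> \<open>\<open>q w\<close> corresponds to a nonzero element of degree \<open>0\<close> of \<open>p v R p v\<close>; it is invertible there, so
    \<open>e\<close> factors through \<open>q w\<close>.\<close>
  have e_span: "e x = act' w (f' (e x))" for x
  proof -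
    have "q w \<in> B.R_degree 0" using q_degree[OF w(1)] by simp
    then obtain \<delta> where \<delta>: "\<delta> \<in> A.R_degree 0" "\<psi> \<delta> = q w" using \<psi>_degree_surj by blast
    note \<delta>_in = A.R_degreeD(1)[OF \<delta>(1)]
    \<comment> \<open>As \<open>e\<close> fixes \<open>w\<close>, also
      \<open>e \<circ> q w = q w\<close>; pulled back, this places \<open>\<delta> v\<close> in
      \<open>v D\<close>.\<close>
    have "\<psi> (p v \<circ> \<delta>) = \<psi> \<delta>"
      using \<psi>_comp[OF p_in \<delta>_in] B.R_D(3)[OF e_in]
      by (simp add: \<delta>(2) q_def e_def[symmetric] e_w fun_eq_iff)
    then have "p v \<circ> \<delta> = \<delta>"
      by (rule \<psi>_inj) (use A.comp_in_R[OF p_in \<delta>_in] \<delta>_in in auto)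
    then have "(p v \<circ> \<delta>) v = \<delta> v" by simp
    then have \<delta>_v: "\<delta> v = act v (f (\<delta> v))" by (simp add: p_def)
    have "\<delta> v \<in> grV a" using A.R_degreeD(2)[OF \<delta>(1) v(1)] by simp
    then have "f (\<delta> v) \<in> grD 0" using f_degree by force
    moreover have "f (\<delta> v) \<noteq> 0"
    proof
      assume "f (\<delta> v) = 0"
      then have "\<delta> = (\<lambda>v. 0)"
        using q_preimage[OF \<delta>_in \<delta>(2)] \<delta>_v by (simp add: p_def)
      then have "q w w = 0" using \<delta>(2) \<psi>_zero by metis
      then show False using q_w w0 by simp
    qed
    ultimately obtain d where d: "f (\<delta> v) * d = 1" using A.D.homogeneous_invertible by blast
    \<comment> \<open>The right inverse \<open>d\<close> of the coefficient of
      \<open>\<delta> v\<close> produces a right factor that turns \<open>\<delta>\<close> into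
      \<open>p v\<close>. Hence \<open>e\<close> is \<open>q w\<close> after another map and takes
      its values in \<open>w D'\<close>.\<close>
    have "\<delta> (act v d) = v"
      using A.R_D(3)[OF \<delta>_in] \<delta>_v d by (metis A.act_mult A.act_one)
    then have "\<delta> \<circ> p (act v d) = p v" using comp_p[OF \<delta>_in] by simp
    then have "e = q w \<circ> \<psi> (p (act v d))"
      using \<psi>_comp[OF \<delta>_in p_in] \<delta>(2) by (metis e_def)
    then obtain c where "e x = act' w c" unfolding q_def by (metis comp_apply)
    then show ?thesis by (simp add: f'_act f'(2))
  qed

  \<comment> \<open>The isomorphism \<open>\<psi>1\<close>: transport \<open>p u\<close> along
    \<open>\<psi>\<close> and evaluate at \<open>w\<close>\<close>
  define \<psi>1 where "\<psi>1 u = \<psi> (p u) w" for u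
  have \<psi>1_equivariant: "\<psi>1 (\<phi> u) = \<psi> \<phi> (\<psi>1 u)" if "\<phi> \<in> A.R" for \<phi> u
    using \<psi>_comp[OF that p_in] comp_p[OF that] by (metis \<psi>1_def comp_apply)
  have \<psi>1_v: "\<psi>1 v = w" using e_w by (simp add: \<psi>1_def e_def)
  have \<psi>1_add: "\<psi>1 (x + y) = \<psi>1 x + \<psi>1 y" for x y
  proof -
    have "p (x + y) = (\<lambda>z. p x z + p y z)" by (simp add: p_def A.act_add_left)
    then show ?thesis using \<psi>_add[OF p_in p_in] by (simp add: \<psi>1_def)
  qed
  have \<psi>1_scale: "\<psi>1 (scaleV k x) = scaleV' k (\<psi>1 x)" for k x
  proof -
    have "p (scaleV k x) = (\<lambda>z. scaleV k (p x z))" by (simp add: p_def A.act_scale_left)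
    then show ?thesis using \<psi>_scale[OF p_in] by (simp add: \<psi>1_def)
  qed
  have \<psi>1_degree: "\<psi>1 u \<in> grV' (h + - a + b)" if "u \<in> grV h" for u h
  proof -
    have "\<psi> (p u) \<in> B.R_degree (h + - a)" by (rule \<psi>_degree_in[OF p_degree[OF that]])
    then show ?thesis unfolding \<psi>1_def by (rule B.R_degreeD(2)[OF _ w(1)])
  qed
  \<comment> \<open>\<open>\<psi> (p u)\<close> absorbs \<open>e\<close> on the right, and
    \<open>e\<close> has its values in \<open>w D'\<close>; so it is determined by its value at
    \<open>w\<close>, which is \<open>\<psi>1 u\<close>.\<close>
  have \<psi>1_inj: "u = u'" if "\<psi>1 u = \<psi>1 u'" for u u'
  proof -
    have *: "\<psi> (p u) x = act' (\<psi>1 u) (f' (e x))" for u x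
    proof -
      have "\<psi> (p u) x = \<psi> (p u) (act' w (f' (e x)))" using \<psi>_p_e[of u x] e_span[of x] by simp
      then show ?thesis using B.R_D(3)[OF \<psi>_in[OF p_in]] by (simp add: \<psi>1_def)
    qed
    have "\<psi> (p u) = \<psi> (p u')" by (rule ext) (simp add: * that)
    then have "p u = p u'" by (rule \<psi>_inj[OF _ p_in p_in])
    then show ?thesis using p_v by metis
  qed
  \<comment> \<open>Since \<open>q u w = u\<close>, a preimage of \<open>u\<close> is found by
    pulling \<open>q u\<close> back along \<open>\<psi>\<close> and evaluating at
    \<open>v\<close>.\<close>
  have \<psi>1_preimage: "\<psi>1 (\<phi> v) = u" if "\<phi> \<in> A.R" "\<psi> \<phi> = q u" for \<phi> u
    using \<psi>1_equivariant[OF that(1), of v] by (simp add: \<psi>1_v that(2) q_w)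
  have \<psi>1_surj: "\<exists>u. \<psi>1 u = x" for x
    using \<psi>_surj[OF q_in] \<psi>1_preimage by metis
  have \<psi>1_bij: "bij \<psi>1"
    unfolding bij_def inj_def surj_def using \<psi>1_inj \<psi>1_surj by metis
  have \<psi>1_gr: "\<psi>1 ` grV h = grV' (h + - a + b)" for h
  proof
    show "\<psi>1 ` grV h \<subseteq> grV' (h + - a + b)" using \<psi>1_degree by blast
    show "grV' (h + - a + b) \<subseteq> \<psi>1 ` grV h"
    proof
      fix x assume "x \<in> grV' (h + - a + b)"
      then have "q x \<in> B.R_degree (h + - a + b + - b)" by (rule q_degree)
      then have "q x \<in> B.R_degree (h + - a)"
        by (simp only: add.assoc right_minus add_0_right)
      then obtain \<phi> where \<phi>: "\<phi> \<in> A.R_degree (h + - a)" "\<psi> \<phi> = q x" using \<psi>_degree_surj by blast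
      have "\<phi> v \<in> grV (h + - a + a)" by (rule A.R_degreeD(2)[OF \<phi>(1) v(1)])
      then have "\<phi> v \<in> grV h" by (simp only: add.assoc left_minus add_0_right)
      then show "x \<in> \<psi>1 ` grV h"
        using \<psi>1_preimage[OF A.R_degreeD(1)[OF \<phi>(1)] \<phi>(2)] by blast
    qed
  qed

  \<comment> \<open>The isomorphism \<open>\<psi>0\<close>, read off from \<open>\<psi>1\<close> on
    \<open>v D\<close>\<close>
  define \<psi>0 where "\<psi>0 d = f' (\<psi>1 (act v d))" for d
  have \<psi>1_act_v: "\<psi>1 (act v d) = act' w (\<psi>0 d)" for d
  proof -
    \<comment> \<open>What \<open>p v\<close> fixes is sent by \<open>\<psi>1\<close> to something
      \<open>e\<close> fixes, hence into \<open>w D'\<close>, where \<open>f'\<close> recovers the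
      coefficient.\<close>
    have "p v (act v d) = act v d" by (simp add: p_def f_act f(2))
    then have "e (\<psi>1 (act v d)) = \<psi>1 (act v d)"
      using \<psi>1_equivariant[OF p_in, of v "act v d"] by (simp add: e_def)
    then show ?thesis using e_span[of "\<psi>1 (act v d)"] by (simp add: \<psi>0_def)
  qed
  have \<psi>1_act: "\<psi>1 (act u d) = act' (\<psi>1 u) (\<psi>0 d)" for u d
  proof -
    have "act u d = p u (act v d)" by (simp add: p_def f_act f(2))
    then have "\<psi>1 (act u d) = \<psi> (p u) (act' w (\<psi>0 d))"
      using \<psi>1_equivariant[OF p_in, of u "act v d"] by (simp add: \<psi>1_act_v)
    then show ?thesis using B.R_D(3)[OF \<psi>_in[OF p_in]] by (simp add: \<psi>1_def)
  qed
  have \<psi>0_add: "\<psi>0 (x + y) = \<psi>0 x + \<psi>0 y" for x y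
    by (simp add: \<psi>0_def A.act_add_right \<psi>1_add f'_add)
  have \<psi>0_scale: "\<psi>0 (scaleD k x) = scaleD' k (\<psi>0 x)" for k x
    by (simp add: \<psi>0_def A.act_scale_right \<psi>1_scale B.functional_scale[OF f'(1)])
  have \<psi>0_mult: "\<psi>0 (x * y) = \<psi>0 x * \<psi>0 y" for x y
  proof (rule B.act_cancel[OF w(1) w0])
    show "act' w (\<psi>0 (x * y)) = act' w (\<psi>0 x * \<psi>0 y)"
      using \<psi>1_act_v[of "x * y"] by (simp add: A.act_mult B.act_mult \<psi>1_act \<psi>1_v)
  qed
  have \<psi>0_one: "\<psi>0 1 = 1" by (simp add: \<psi>0_def A.act_one \<psi>1_v f'(2))
  have \<psi>0_inj: "x = y" if "\<psi>0 x = \<psi>0 y" for x y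
    by (rule A.act_cancel[OF v(1) v0], rule \<psi>1_inj) (simp add: \<psi>1_act_v that)
  have \<psi>0_preimage: "\<psi>0 (f u) = c" if "\<psi>1 u = act' w c" for u c
  proof -
    \<comment> \<open>Conversely, a vector with image in \<open>w D'\<close> is fixed by
      \<open>p v\<close>, so it equals \<open>v\<close> acted on by \<open>f u\<close>.\<close>
    have "\<psi>1 (p v u) = e (act' w c)"
      using \<psi>1_equivariant[OF p_in, of v u] by (simp add: e_def that)
    also have "\<dots> = \<psi>1 u" using B.R_D(3)[OF e_in] by (simp add: that e_w)
    finally have "act v (f u) = u" using \<psi>1_inj by (simp add: p_def)
    then show ?thesis by (simp add: \<psi>0_def that f'_act f'(2))
  qed
  have \<psi>0_bij: "bij \<psi>0"
    unfolding bij_def inj_def surj_def using \<psi>0_inj \<psi>0_preimage \<psi>1_surj by metis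

  \<comment> \<open>The shift \<open>g\<close> and the degrees of \<open>\<psi>0\<close>\<close>
  define g where "g = - a + b"
  have g_minus: "- g = - b + a" by (simp only: g_def minus_add minus_minus)
  note group = add.assoc g_def g_minus[unfolded g_def] minus_add_cancel add_minus_cancel
    minus_minus left_minus right_minus add_0_right add_0_left
  \<comment> \<open>For \<open>d\<close> of degree \<open>k\<close>, the vector \<open>v d\<close>
    has degree \<open>a + k\<close>, its image has degree \<open>a + k + - a + b\<close>, and
    \<open>f'\<close> adds \<open>- b\<close> on the left. So \<open>\<psi>0\<close> sends degree
    \<open>k\<close> to \<open>- g + k + g\<close>.\<close>
  have \<psi>0_gr: "\<psi>0 ` grD (g + h + - g) = grD' h" for h
  proof
    show "\<psi>0 ` grD (g + h + - g) \<subseteq> grD' h"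
    proof
      fix c assume "c \<in> \<psi>0 ` grD (g + h + - g)"
      then obtain d where d: "d \<in> grD (g + h + - g)" "c = \<psi>0 d" by blast
      have "\<psi>0 d \<in> grD' (- b + (a + (g + h + - g) + - a + b))"
        unfolding \<psi>0_def by (rule f'_degree[OF \<psi>1_degree[OF A.act_degree[OF v(1) d(1)]]])
      then show "c \<in> grD' h" unfolding d(2) by (simp only: group)
    qed
    show "grD' h \<subseteq> \<psi>0 ` grD (g + h + - g)"
    proof
      fix c assume c: "c \<in> grD' h"
      \<comment> \<open>The degree that \<open>\<psi>1\<close> carries to \<open>b + h\<close>, the
        degree of \<open>w c\<close>.\<close>
      let ?k = "b + h + - b + a"
      have "?k + - a + b = b + h" by (simp only: group)
      then have "act' w c \<in> grV' (?k + - a + b)" using B.act_degree[OF w(1) c] by (simp only:)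
      then obtain u where u: "u \<in> grV ?k" "act' w c = \<psi>1 u" using \<psi>1_gr[of ?k] by blast
      have "f u \<in> grD (- a + ?k)" by (rule f_degree[OF u(1)])
      then have "f u \<in> grD (g + h + - g)" by (simp only: group)
      then show "c \<in> \<psi>0 ` grD (g + h + - g)" using \<psi>0_preimage[OF u(2)[symmetric]] by blast
    qed
  qed

  \<comment> \<open>Transport of the flag by \<open>\<psi>1\<close>\<close>
  have \<psi>1_component: "B.V.component (h + - a + b) (\<psi>1 u) = \<psi>1 (A.V.component h u)" for h u
    by (rule component_additive_map[where \<sigma> = "\<lambda>h. h + - a + b"])
      (unfold_locales, auto simp: \<psi>1_add \<psi>1_degree inj_def simp del: add_uminus_conv_diff)
  have \<psi>1_component': "B.V.component h (\<psi>1 u) = \<psi>1 (A.V.component (h + - b + a) u)" for h u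
  proof -
    have "h + - b + a + - a + b = h" by (simp only: group)
    then show ?thesis using \<psi>1_component[of "h + - b + a" u] by (simp only:)
  qed
  have \<psi>1_zero: "\<psi>1 0 = 0" using \<psi>1_add[of 0 0] by simp
  have image_submodule: "B.graded_submodule (\<psi>1 ` S)" if S: "A.graded_submodule S" for S
    unfolding B.graded_submodule_def
  proof (intro conjI ballI allI)
    note S = A.graded_submoduleD[OF S]
    have "\<psi>1 0 \<in> \<psi>1 ` S" by (rule imageI[OF S(1)])
    then show "0 \<in> \<psi>1 ` S" by (simp only: \<psi>1_zero)
    fix x assume "x \<in> \<psi>1 ` S"
    then obtain u where u: "u \<in> S" "x = \<psi>1 u" by blast
    show "x + y \<in> \<psi>1 ` S" if "y \<in> \<psi>1 ` S" for y
    proof -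
      obtain u' where u': "u' \<in> S" "y = \<psi>1 u'" using \<open>y \<in> \<psi>1 ` S\<close> by blast
      have "\<psi>1 (u + u') \<in> \<psi>1 ` S" by (rule imageI[OF S(2)[OF u(1) u'(1)]])
      then show ?thesis by (simp only: \<psi>1_add u(2) u'(2))
    qed
    show "B.V.component h x \<in> \<psi>1 ` S" for h
      unfolding u(2) \<psi>1_component' by (rule imageI[OF S(4)[OF u(1)]])
    show "\<chi> x \<in> \<psi>1 ` S" if "\<chi> \<in> B.R" for \<chi>
    proof -
      obtain \<phi> where \<phi>: "\<phi> \<in> A.R" "\<psi> \<phi> = \<chi>" using \<psi>_surj[OF \<open>\<chi> \<in> B.R\<close>] by blast
      have "\<psi>1 (\<phi> u) \<in> \<psi>1 ` S" by (rule imageI[OF S(3)[OF \<phi>(1) u(1)]])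
      then show ?thesis by (simp only: \<psi>1_equivariant[OF \<phi>(1)] \<phi>(2) u(2))
    qed
  qed
  have vimage_submodule: "A.graded_submodule (\<psi>1 -` T)" if T: "B.graded_submodule T" for T
    using T \<psi>_in \<psi>1_component[symmetric]
    by (simp add: A.graded_submodule_def B.graded_submodule_def \<psi>1_zero \<psi>1_add \<psi>1_equivariant)
  \<comment> \<open>Graded submodules correspond under \<open>\<psi>1\<close>, and on each side they
    are exactly the members of the flag. The two chains thus have the same set of members, which
    fixes lengths and indices.\<close>
  have "F' ` {..r'} = {T. B.graded_submodule T}" using B.graded_submodule_iff by blast
  also have "\<dots> = image \<psi>1 ` {S. A.graded_submodule S}"
  proof (intro equalityI subsetI)
    fix T assume "T \<in> {T. B.graded_submodule T}"
    then have "A.graded_submodule (\<psi>1 -` T)" using vimage_submodule by simp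
    moreover have "T = \<psi>1 ` (\<psi>1 -` T)" using \<psi>1_bij by (simp add: bij_def surj_image_vimage_eq)
    ultimately show "T \<in> image \<psi>1 ` {S. A.graded_submodule S}" by blast
  qed (use image_submodule in auto)
  also have "{S. A.graded_submodule S} = F ` {..r}" using A.graded_submodule_iff by blast
  finally have chains: "(\<lambda>i. \<psi>1 ` F i) ` {..r} = F' ` {..r'}" by (simp add: image_image)
  have "\<psi>1 ` F i \<subset> \<psi>1 ` F j" if "i < j" "j \<le> r" for i j
    using A.F_less[OF that] \<psi>1_bij by (simp add: bij_def inj_image_subset_iff psubset_eq inj_image_eq_iff)
  note strict = strict_chains_equal[of r "\<lambda>i. \<psi>1 ` F i" r' F', OF this B.F_less chains]

  \<comment> \<open>Assembling the isomorphism of pairs\<close>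
  have lin0: "Vector_Spaces.linear scaleD scaleD' \<psi>0"
    by unfold_locales (simp_all add: \<psi>0_add \<psi>0_scale)
  have lin1: "Vector_Spaces.linear scaleV scaleV' \<psi>1"
    by unfold_locales (simp_all add: \<psi>1_add \<psi>1_scale)
  have "\<psi>0 ` lshift (- g) (rshift g grD) h = grD' h" for h
    using \<psi>0_gr[of h] by (simp only: lshift_def rshift_def minus_minus)
  then have "graded_algebra_iso scaleD (lshift (- g) (rshift g grD)) scaleD' grD' \<psi>0"
    unfolding graded_algebra_iso_def graded_space_iso_def
    using lin0 \<psi>0_bij \<psi>0_mult \<psi>0_one by blast
  \<comment> \<open>The shifted component in degree \<open>h\<close> is the original one in degree
    \<open>h + - g\<close>, and \<open>\<psi>1\<close> translates degrees by \<open>g\<close> on the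
    right.\<close>
  moreover have "\<psi>1 ` rshift g grV h = grV' h" for h
    using \<psi>1_gr[of "h + - g"] by (simp only: rshift_def group)
  then have "graded_space_iso scaleV (rshift g grV) scaleV' grV' \<psi>1"
    unfolding graded_space_iso_def using lin1 \<psi>1_bij by blast
  ultimately have "pair_iso r scaleD (lshift (- g) (rshift g grD)) scaleV (rshift g grV) act F
      scaleD' grD' scaleV' grV' act' F' \<psi>0 \<psi>1"
    unfolding pair_iso_def using strict(2) \<psi>1_act by blast
  then show ?thesis using strict(1) \<psi>1_equivariant by blast
qed

end
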